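(* Let $\mathcal{H}$ be a complex Hilbert space, let $A,B\in L(\mathcal{H})$ be such that $R(A+B)$ is closed and $R(A+B)=R(A)\dotplus R(B)$ (that is, $A$ is below $A+B$ in the left minus order), and let $c\in\mathcal{H}$. Let $P\in L(\mathcal{H})$ be any optimal idempotent for $A$ and $B$ such that $A=P(A+B)$, and let $W=P^*P+(I-P^* )(I-P)$. Then for $x_0\in\mathcal{H}$ the following statements are equivalent: (1) $x_0$ is a minimizer of $x\mapsto\|(A+B)x-c\|$ over $x\in\mathcal{H}$; (2) $x_0$ is simultaneously a minimizer of $x\mapsto\|Ax-c\|_W$ over $\mathcal{H}$ and a minimizer of $x\mapsto\|Bx-c\|_W$ over $\mathcal{H}$.
   Context: $L(\mathcal{H})$ is the algebra of bounded linear operators on $\mathcal{H}$, $R(T)$ is the range of $T$, and $\dotplus$ denotes a direct (algebraic) sum of linear subspaces (trivial intersection). For a positive semidefinite $W\in L(\mathcal{H})$, $\|x\|_W=\langle Wx,x\rangle^{1/2}$. $P_T$ denotes the orthogonal projection onto $\overline{R(T)}$. An idempotent $P\in L(\mathcal{H})$ with $A=P(A+B)$ is called optimal for $A$ and $B$ if $P_AP+P_B(I-P)$ is selfadjoint. *)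

theory Defs
  imports "HOL-Analysis.Analysis"
begin

text \<open>Complex inner product spaces, built on top of the library's real ones: the real part of the
  complex inner product is the real inner product, so that norm and topology (and positive
  definiteness) are those of \<^class>\<open>real_inner\<close>. The inner product is linear in its first argument.\<close>

class complex_inner = real_inner +
  fixes scaleC :: "complex \<Rightarrow> 'a \<Rightarrow> 'a"  (infixr "*\<^sub>C" 75)
    and cinner :: "'a \<Rightarrow> 'a \<Rightarrow> complex"
  assumes scaleC_add_right: "a *\<^sub>C (x + y) = a *\<^sub>C x + a *\<^sub>C y"
    and scaleC_add_left: "(a + b) *\<^sub>C x = a *\<^sub>C x + b *\<^sub>C x"
    and scaleC_scaleC: "a *\<^sub>C (b *\<^sub>C x) = (a * b) *\<^sub>C x"
    and scaleC_of_real: "complex_of_real r *\<^sub>C x = r *\<^sub>R x"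
    and cinner_commute: "cinner x y = cnj (cinner y x)"
    and cinner_add_left: "cinner (x + y) z = cinner x z + cinner y z"
    and cinner_scaleC_left: "cinner (a *\<^sub>C x) y = a * cinner x y"
    and Re_cinner: "Re (cinner x y) = inner x y"

class chilbert_space = complex_inner + complete_space

instantiation complex :: chilbert_space
begin

definition scaleC_complex :: "complex \<Rightarrow> complex \<Rightarrow> complex"
  where "scaleC_complex a x = a * x"

definition cinner_complex :: "complex \<Rightarrow> complex \<Rightarrow> complex"
  where "cinner_complex x y = x * cnj y"

instance
  by standard
    (auto simp: scaleC_complex_def cinner_complex_def algebra_simps inner_complex_def scaleR_conv_of_real)

end

locale bounded_clinear = bounded_linear f
  for f :: "'a::complex_inner \<Rightarrow> 'b::complex_inner" +
  assumes scaleC: "f (a *\<^sub>C x) = a *\<^sub>C f x"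

definition cadjoint :: "('a::complex_inner \<Rightarrow> 'b::complex_inner) \<Rightarrow> 'b \<Rightarrow> 'a"
  where "cadjoint T = (THE S. \<forall>x y. cinner (T x) y = cinner x (S y))"

definition selfadjoint :: "('a::complex_inner \<Rightarrow> 'a) \<Rightarrow> bool"
  where "selfadjoint T \<longleftrightarrow> cadjoint T = T"

text \<open>Meaningful when \<open>M\<close> is a closed complex subspace of a Hilbert space.\<close>

definition orth_proj :: "'a::complex_inner set \<Rightarrow> 'a \<Rightarrow> 'a"
  where "orth_proj M x = (THE y. y \<in> M \<and> (\<forall>z\<in>M. cinner (x - y) z = 0))"

definition range_proj :: "('a::complex_inner \<Rightarrow> 'b::complex_inner) \<Rightarrow> 'b \<Rightarrow> 'b"
  where "range_proj T = orth_proj (closure (range T))"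

definition is_direct_sum :: "'a::real_vector set \<Rightarrow> 'a set \<Rightarrow> 'a set \<Rightarrow> bool"
  where "is_direct_sum S M N \<longleftrightarrow> S = {x + y | x y. x \<in> M \<and> y \<in> N} \<and> M \<inter> N = {0}"

definition optimal_idempotent ::
    "('a::complex_inner \<Rightarrow> 'a) \<Rightarrow> ('a \<Rightarrow> 'a) \<Rightarrow> ('a \<Rightarrow> 'a) \<Rightarrow> bool"
  where "optimal_idempotent A B P \<longleftrightarrow>
    bounded_clinear P \<and> (\<forall>x. P (P x) = P x) \<and>
    (\<forall>x. A x = P (A x + B x)) \<and>
    selfadjoint (\<lambda>x. range_proj A (P x) + range_proj B (x - P x))"

text \<open>For positive semidefinite \<open>W\<close> the number \<^term>\<open>cinner (W x) x\<close> is real and nonnegative, so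
  that taking the real part loses nothing.\<close>

definition wnorm :: "('a::complex_inner \<Rightarrow> 'a) \<Rightarrow> 'a \<Rightarrow> real"
  where "wnorm W x = sqrt (Re (cinner (W x) x))"

text \<open>The operator \<open>P* P + (I - P*) (I - P)\<close>.\<close>

definition weight :: "('a::complex_inner \<Rightarrow> 'a) \<Rightarrow> 'a \<Rightarrow> 'a"
  where "weight P x = cadjoint P (P x) + ((x - P x) - cadjoint P (x - P x))"

end

theory Submission
  imports Defs
begin

text \<open>Write \<open>S = A + B\<close> and \<open>T = P\<^sub>A P + P\<^sub>B (I - P)\<close>. Since \<open>P\<close> is the identity on \<open>R(A)\<close> and
  vanishes on \<open>R(B)\<close>, the operator \<open>T\<close> fixes \<open>R(S)\<close> and maps into it, as \<open>R(S)\<close> is closed; being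
  selfadjoint, it is the orthogonal projection onto \<open>R(S)\<close>. Hence \<open>x\<^sub>0\<close> minimizes
  \<open>\<parallel>S x - c\<parallel>\<close> iff \<open>S x\<^sub>0 = T c\<close>. On the other hand \<open>\<parallel>y\<parallel>\<^sub>W\<^sup>2 = \<parallel>P y\<parallel>\<^sup>2 + \<parallel>y - P y\<parallel>\<^sup>2\<close>, so the two
  weighted problems are those of minimizing \<open>\<parallel>A x - P c\<parallel>\<close> and \<open>\<parallel>B x - (c - P c)\<parallel>\<close>, solved by
  \<open>A x\<^sub>0 = P\<^sub>A P c\<close> and \<open>B x\<^sub>0 = P\<^sub>B (c - P c)\<close>. Applying \<open>P\<close> and \<open>I - P\<close> to \<open>S x\<^sub>0 = T c\<close> yields
  exactly these two equations.\<close>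

section \<open>Projections and adjoints in Hilbert space\<close>

text \<open>One direction perturbs \<open>y\<close> along \<open>z\<close>, the other is Pythagoras.
  Real inner products suffice here; complex orthogonality is recovered by
  \<open>cinner_zero_iff_inner_zero\<close>.\<close>

lemma closest_point_subspace_iff:
  fixes M :: "'a::real_inner set"
  assumes M: "subspace M" and y: "y \<in> M"
  shows "(\<forall>z\<in>M. norm (x - y) \<le> norm (x - z)) \<longleftrightarrow> (\<forall>z\<in>M. inner (x - y) z = 0)"
proof
  assume min: "\<forall>z\<in>M. norm (x - y) \<le> norm (x - z)"
  show "\<forall>z\<in>M. inner (x - y) z = 0"
  proof
    fix z assume z: "z \<in> M"
    show "inner (x - y) z = 0"
    proof (cases "z = 0")
      case False
      \<comment> \<open>This \<open>t\<close> minimizes the quadratic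
        \<open>norm (x - y - t *\<^sub>R z)\<close> squared, so any nonzero inner product would give
        a strictly closer point.\<close>
      define t where "t = inner (x - y) z / inner z z"
      have pos: "inner z z > 0" using False by simp
      have "y + t *\<^sub>R z \<in> M" using M y z by (simp add: subspace_add subspace_scale)
      then have "norm (x - y) \<le> norm (x - y - t *\<^sub>R z)" using min by (metis diff_diff_add)
      then have "inner (x - y) (x - y) \<le> inner (x - y - t *\<^sub>R z) (x - y - t *\<^sub>R z)"
        by (simp add: norm_le)
      also have "\<dots> = inner (x - y) (x - y) - 2 * t * inner (x - y) z + t * t * inner z z"
        by (simp add: inner_diff_left inner_diff_right inner_commute algebra_simps)
      also have "\<dots> = inner (x - y) (x - y) - (inner (x - y) z)\<^sup>2 / inner z z"
        using pos by (simp add: t_def power2_eq_square)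
      finally have "(inner (x - y) z)\<^sup>2 / inner z z \<le> 0" by simp
      then show ?thesis using pos by (simp add: divide_le_0_iff)
    qed simp
  qed
next
  assume orth: "\<forall>z\<in>M. inner (x - y) z = 0"
  show "\<forall>z\<in>M. norm (x - y) \<le> norm (x - z)"
  proof
    fix z assume "z \<in> M"
    then have "inner (x - y) (y - z) = 0" using orth M y by (simp add: subspace_diff)
    then have "inner (x - z) (x - z) = inner (x - y) (x - y) + inner (y - z) (y - z)"
      by (simp add: inner_diff_left inner_diff_right inner_commute)
    then have "(norm (x - y))\<^sup>2 \<le> (norm (x - z))\<^sup>2" by (simp add: power2_norm_eq_inner)
    then show "norm (x - y) \<le> norm (x - z)" by (simp add: power2_le_iff_abs_le)
  qed
qed

text \<open>The sets \<open>C n\<close> of near-minimizers are closed, nested and nonempty, and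
  their diameters shrink to 0; completeness gives a common point, which attains the distance
  \<open>d\<close>.\<close>

lemma ex_closest_point_subspace:
  fixes M :: "'a::{real_inner,complete_space} set"
  assumes M: "subspace M" and cl: "closed M"
  shows "\<exists>y\<in>M. \<forall>z\<in>M. norm (x - y) \<le> norm (x - z)"
proof -
  define d where "d = infdist x M"
  have ne: "M \<noteq> {}" using subspace_0[OF M] by blast
  have d0: "d \<ge> 0" by (simp add: d_def infdist_nonneg)
  have dle: "d \<le> norm (x - z)" if "z \<in> M" for z
    using infdist_le[OF that, of x] by (simp add: d_def dist_norm)
  define C where "C n = M \<inter> cball x (d + inverse (Suc n))" for n
  have C_iff: "z \<in> C n \<longleftrightarrow> z \<in> M \<and> norm (x - z) \<le> d + inverse (Suc n)" for z n
    by (auto simp: C_def dist_norm)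
  have "closed (C n)" for n by (simp add: C_def cl closed_Int)
  moreover have "C n \<noteq> {}" for n
  proof -
    have "infdist x M < d + inverse (Suc n)" by (simp add: d_def)
    then obtain z where "z \<in> M" "dist x z < d + inverse (Suc n)"
      using ne by (auto simp: infdist_def cINF_less_iff)
    then show ?thesis by (auto simp: C_def intro: less_imp_le)
  qed
  moreover have "C n \<subseteq> C m" if "m \<le> n" for m n
  proof -
    have "d + inverse (real (Suc n)) \<le> d + inverse (real (Suc m))"
      using that by (simp add: le_imp_inverse_le)
    from subset_cball[OF this] show ?thesis unfolding C_def by blast
  qed
  moreover have "\<exists>n. \<forall>u\<in>C n. \<forall>v\<in>C n. dist u v < e" if e: "e > 0" for e
  proof -
    \<comment> \<open>Parallelogram law for \<open>x - u\<close> and \<open>x - v\<close>: the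
      midpoint of \<open>u\<close> and \<open>v\<close> lies in \<open>M\<close>, hence at distance
      at least \<open>d\<close> from \<open>x\<close>.\<close>
    have diam: "(dist u v)\<^sup>2 \<le> 4 * ((d + r)\<^sup>2 - d\<^sup>2)"
      if u: "u \<in> C n" and v: "v \<in> C n" and r: "r = inverse (real (Suc n))" for u v n r
    proof -
      have m: "(1/2) *\<^sub>R (u + v) \<in> M"
        using u v by (simp add: C_iff M subspace_add subspace_scale)
      have "(norm (x - u))\<^sup>2 \<le> (d + r)\<^sup>2" "(norm (x - v))\<^sup>2 \<le> (d + r)\<^sup>2"
        using u v r by (auto simp: C_iff intro!: power_mono)
      moreover have "d\<^sup>2 \<le> (norm (x - (1/2) *\<^sub>R (u + v)))\<^sup>2"
        using dle[OF m] d0 by (rule power_mono)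
      moreover have "(norm (u - v))\<^sup>2 =
          2 * (norm (x - u))\<^sup>2 + 2 * (norm (x - v))\<^sup>2 - 4 * (norm (x - (1/2) *\<^sub>R (u + v)))\<^sup>2"
        by (simp add: power2_norm_eq_inner inner_diff_left inner_diff_right inner_add_left
            inner_add_right inner_commute algebra_simps)
      ultimately show ?thesis by (simp add: dist_norm)
    qed
    have "(\<lambda>n. 4 * ((d + inverse (real (Suc n)))\<^sup>2 - d\<^sup>2)) \<longlonglongrightarrow> 4 * ((d + 0)\<^sup>2 - d\<^sup>2)"
      by (intro tendsto_intros LIMSEQ_inverse_real_of_nat)
    then have "\<forall>\<^sub>F n in sequentially. 4 * ((d + inverse (real (Suc n)))\<^sup>2 - d\<^sup>2) < e\<^sup>2"
      using e by (intro order_tendstoD) auto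
    then obtain n where n: "4 * ((d + inverse (real (Suc n)))\<^sup>2 - d\<^sup>2) < e\<^sup>2"
      by (auto simp: eventually_sequentially)
    have "dist u v < e" if "u \<in> C n" "v \<in> C n" for u v
      using diam[OF that refl] n e by (intro power2_less_imp_less[of "dist u v" e]) linarith+
    then show ?thesis by blast
  qed
  ultimately obtain y where y: "\<And>n. y \<in> C n"
    using decreasing_closed_nest[of C] by metis
  have "(\<lambda>n. d + inverse (real (Suc n))) \<longlonglongrightarrow> d + 0"
    by (intro tendsto_intros LIMSEQ_inverse_real_of_nat)
  then have "norm (x - y) \<le> d + 0"
    by (rule LIMSEQ_le_const) (use y in \<open>auto simp: C_iff\<close>)
  then show ?thesis using y dle by (intro bexI[of _ y]) (auto simp: C_iff intro: order_trans)
qed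

text \<open>The residual \<open>w\<close> of \<open>u\<close> after projection onto the kernel is
  orthogonal to the kernel, and every \<open>x\<close> differs from a multiple of \<open>w\<close>
  by a kernel element.\<close>

lemma riesz_representation:
  fixes f :: "'a::{real_inner,complete_space} \<Rightarrow> real"
  assumes "bounded_linear f"
  shows "\<exists>s. \<forall>x. f x = inner x s"
proof (cases "\<forall>x. f x = 0")
  case True
  then show ?thesis by (intro exI[of _ 0]) simp
next
  case False
  interpret f: bounded_linear f by fact
  from False obtain u where u: "f u \<noteq> 0" by blast
  let ?K = "{x. f x = 0}"
  have K: "subspace ?K" by (auto simp: subspace_def f.add f.scaleR f.zero)
  have "closed ?K"
    by (intro closed_Collect_eq continuous_intros f.continuous_on)
  from ex_closest_point_subspace[OF K this, of u] obtain p where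
    p: "f p = 0" and "\<forall>z\<in>?K. norm (u - p) \<le> norm (u - z)" by blast
  then have orth: "inner (u - p) z = 0" if "f z = 0" for z
    using closest_point_subspace_iff[OF K, of p u] that by simp
  define w where "w = u - p"
  have fw: "f w \<noteq> 0" using u p by (simp add: w_def f.diff)
  then have ww: "inner w w \<noteq> 0" using f.zero by auto
  have "f x = inner x ((f w / inner w w) *\<^sub>R w)" for x
  proof -
    have "f (x - (f x / f w) *\<^sub>R w) = 0" using fw by (simp add: f.diff f.scaleR)
    from orth[OF this] have "inner w x = f x / f w * inner w w"
      by (simp add: w_def[symmetric] inner_diff_right)
    then show ?thesis using fw ww by (simp add: inner_commute)
  qed
  then show ?thesis by blast
qed

section \<open>Complex adjoints and complex orthogonality\<close>

lemma Im_cinner: "Im (cinner x y) = - inner (\<i> *\<^sub>C x) y"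
  by (simp flip: Re_cinner add: cinner_scaleC_left)

text \<open>Shows that the description in \<open>cadjoint\<close> denotes. Riesz yields
  \<open>S\<close> for the real inner product; since \<open>T\<close> commutes with multiplication
  by \<open>\<i>\<close>, the imaginary parts agree too.\<close>

lemma cadjoint_works:
  fixes T :: "'a::chilbert_space \<Rightarrow> 'b::complex_inner"
  assumes "bounded_clinear T"
  shows "cinner (T x) y = cinner x (cadjoint T y)"
proof -
  interpret T: bounded_clinear T by fact
  have "\<exists>s. \<forall>x. inner (T x) y = inner x s" for y
    by (intro riesz_representation bounded_linear_compose[OF bounded_linear_inner_left]
        T.bounded_linear_axioms)
  then obtain S where S: "\<And>x y. inner (T x) y = inner x (S y)" by metis
  have S': "cinner (T x) y = cinner x (S y)" for x y
    by (rule complex_eqI) (simp_all add: Re_cinner Im_cinner S flip: T.scaleC)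
  have "\<forall>x y. cinner (T x) y = cinner x (cadjoint T y)"
    unfolding cadjoint_def
  proof (rule theI[of _ S])
    fix R assume "\<forall>x y. cinner (T x) y = cinner x (R y)"
    then have "inner x (R y) = inner x (S y)" for x y by (simp add: S' flip: Re_cinner)
    then have "R y = S y" for y by (subst vector_eq_ldot[symmetric]) simp
    then show "R = S" by (rule ext)
  qed (simp add: S')
  then show ?thesis by blast
qed

lemma inner_cadjoint:
  fixes T :: "'a::chilbert_space \<Rightarrow> 'b::complex_inner"
  assumes "bounded_clinear T"
  shows "inner (T x) y = inner x (cadjoint T y)"
  using cadjoint_works[OF assms, of x y] by (simp flip: Re_cinner)

lemma cinner_scaleC_right: "cinner x (a *\<^sub>C y) = cnj a * cinner x y"
  by (metis cinner_commute cinner_scaleC_left complex_cnj_mult)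

text \<open>Real orthogonality to \<open>\<i> *\<^sub>C z\<close>, also in \<open>M\<close>, kills
  the imaginary part of \<open>cinner w z\<close>.\<close>

lemma cinner_zero_iff_inner_zero:
  assumes "\<And>a z. z \<in> M \<Longrightarrow> a *\<^sub>C z \<in> M"
  shows "(\<forall>z\<in>M. cinner w z = 0) \<longleftrightarrow> (\<forall>z\<in>M. inner w z = 0)"
proof (intro iffI ballI)
  fix z assume "z \<in> M" and *: "\<forall>z\<in>M. inner w z = 0"
  have "Re (cinner w z) = 0" using * \<open>z \<in> M\<close> by (simp add: Re_cinner)
  moreover have "Re (cinner w (\<i> *\<^sub>C z)) = 0" using * \<open>z \<in> M\<close> assms by (simp add: Re_cinner)
  ultimately show "cinner w z = 0" by (simp add: cinner_scaleC_right complex_eq_iff)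
qed (metis Re_cinner zero_complex.simps(1))

lemma bounded_linear_scaleC: "bounded_linear (\<lambda>x::'a::complex_inner. a *\<^sub>C x)"
proof (rule bounded_linear_intro)
  fix x y :: 'a and r :: real
  show "a *\<^sub>C (x + y) = a *\<^sub>C x + a *\<^sub>C y" by (rule scaleC_add_right)
  show "a *\<^sub>C r *\<^sub>R x = r *\<^sub>R a *\<^sub>C x"
    by (simp add: scaleC_scaleC mult.commute flip: scaleC_of_real)
  have "inner (a *\<^sub>C x) (a *\<^sub>C x) = Re (a * cnj a * cinner x x)"
    by (simp only: cinner_scaleC_left cinner_scaleC_right mult.assoc mult.left_commute flip: Re_cinner)
  also have "\<dots> = (norm a)\<^sup>2 * inner x x"
    by (simp add: Re_cinner flip: complex_norm_square of_real_power)
  finally have "(norm (a *\<^sub>C x))\<^sup>2 = (norm x * norm a)\<^sup>2"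
    by (simp add: power2_norm_eq_inner power_mult_distrib mult.commute)
  then show "norm (a *\<^sub>C x) \<le> norm x * norm a" by (simp add: power2_eq_iff_nonneg)
qed

section \<open>Orthogonal projection onto the closure of a range\<close>

lemma subspace_closure:
  fixes M :: "'a::real_normed_vector set"
  assumes M: "subspace M"
  shows "subspace (closure M)"
proof (rule subspaceI)
  show "0 \<in> closure M" using subspace_0[OF M] closure_subset by blast
next
  fix x y assume "x \<in> closure M" "y \<in> closure M"
  then obtain f g where "\<And>n. f n \<in> M" "f \<longlonglongrightarrow> x" "\<And>n. g n \<in> M" "g \<longlonglongrightarrow> y"
    unfolding closure_sequential by blast
  then show "x + y \<in> closure M"
    unfolding closure_sequential
    by (intro exI[of _ "\<lambda>n. f n + g n"]) (auto intro: tendsto_add subspace_add[OF M])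
next
  fix x and r :: real assume "x \<in> closure M"
  then obtain f where "\<And>n. f n \<in> M" "f \<longlonglongrightarrow> x"
    unfolding closure_sequential by blast
  then show "r *\<^sub>R x \<in> closure M"
    unfolding closure_sequential
    by (intro exI[of _ "\<lambda>n. r *\<^sub>R f n"]) (auto intro: tendsto_scaleR subspace_scale[OF M])
qed

context bounded_clinear
begin

lemma closure_range_subspace: "subspace (closure (range f))"
  by (intro subspace_closure linear_subspace_image linear_axioms subspace_UNIV)

lemma closure_range_scaleC: "z \<in> closure (range f) \<Longrightarrow> a *\<^sub>C z \<in> closure (range f)"
proof -
  assume "z \<in> closure (range f)"
  then have "a *\<^sub>C z \<in> closure ((\<lambda>x. a *\<^sub>C x) ` range f)"
    using closure_bounded_linear_image_subset[OF bounded_linear_scaleC] by blast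
  moreover have "(\<lambda>x. a *\<^sub>C x) ` range f \<subseteq> range f" by (auto simp flip: scaleC)
  ultimately show ?thesis using closure_mono by blast
qed

end

text \<open>Replaces the description in \<open>orth_proj\<close> by a testable condition. Existence
  is the closest point; for uniqueness, the difference of two candidates is orthogonal to
  itself.\<close>

lemma range_proj_eq_iff:
  fixes f :: "'a::complex_inner \<Rightarrow> 'b::chilbert_space"
  assumes "bounded_clinear f"
  shows "range_proj f x = y \<longleftrightarrow>
    y \<in> closure (range f) \<and> (\<forall>z\<in>closure (range f). inner (x - y) z = 0)"
proof -
  interpret bounded_clinear f by fact
  let ?M = "closure (range f)"
  define Q where "Q y \<longleftrightarrow> y \<in> ?M \<and> (\<forall>z\<in>?M. inner (x - y) z = 0)" for y
  have def: "range_proj f x = (THE y. Q y)"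
    unfolding range_proj_def orth_proj_def Q_def
    by (subst cinner_zero_iff_inner_zero) (auto intro: closure_range_scaleC)
  obtain y0 where y0: "Q y0"
    using ex_closest_point_subspace[OF closure_range_subspace closed_closure, of x]
      closest_point_subspace_iff[OF closure_range_subspace] unfolding Q_def by metis
  have uniq: "y = y'" if "Q y" "Q y'" for y y'
  proof -
    have "y - y' \<in> ?M" using that closure_range_subspace by (auto simp: Q_def subspace_diff)
    then have "inner (x - y') (y - y') - inner (x - y) (y - y') = 0" using that by (auto simp: Q_def)
    then show ?thesis by (simp flip: inner_diff_left)
  qed
  have "Q (range_proj f x)" unfolding def by (rule theI[of Q]) (use y0 uniq in auto)
  then show ?thesis using uniq unfolding Q_def[symmetric] by blast
qed

lemma bounded_clinear_range_proj:
  fixes f :: "'a::complex_inner \<Rightarrow> 'b::chilbert_space"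
  assumes f: "bounded_clinear f"
  shows "bounded_clinear (range_proj f)"
proof -
  interpret bounded_clinear f by fact
  let ?M = "closure (range f)" and ?p = "range_proj f"
  have p: "?p x \<in> ?M" and orth: "z \<in> ?M \<Longrightarrow> inner (x - ?p x) z = 0" for x z
    using range_proj_eq_iff[OF f, of x "?p x"] by auto
  have corth: "cinner (x - ?p x) z = 0" if "z \<in> ?M" for x z
    using cinner_zero_iff_inner_zero[of ?M "x - ?p x"] closure_range_scaleC orth that by blast
  note M = closure_range_subspace
  have scaleC: "?p (a *\<^sub>C x) = a *\<^sub>C ?p x" for a x
  proof -
    \<comment> \<open>Real orthogonality to a single \<open>z\<close> does not survive complex
      scaling of the residual, so the complex form \<open>corth\<close> is used.\<close>
    have "inner (a *\<^sub>C x - a *\<^sub>C ?p x) z = 0" if "z \<in> ?M" for z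
    proof -
      have "a *\<^sub>C x - a *\<^sub>C ?p x = a *\<^sub>C (x - ?p x)"
        by (simp add: linear_diff[OF bounded_linear.linear[OF bounded_linear_scaleC]])
      then show ?thesis using corth[OF that] by (simp add: cinner_scaleC_left flip: Re_cinner)
    qed
    then show ?thesis using p by (simp add: range_proj_eq_iff[OF f] closure_range_scaleC)
  qed
  show ?thesis
  proof
    fix x y
    show "?p (x + y) = ?p x + ?p y"
      using p orth by (simp add: range_proj_eq_iff[OF f] M subspace_add add_diff_add inner_add_left)
    show "?p (r *\<^sub>R x) = r *\<^sub>R ?p x" for r
      using scaleC[of "complex_of_real r" x] by (simp add: scaleC_of_real)
    show "?p (a *\<^sub>C x) = a *\<^sub>C ?p x" for a by (rule scaleC)
    have "norm (?p x) \<le> norm x * 1" for x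
    proof -
      have "(norm (?p x))\<^sup>2 = inner x (?p x)"
        using orth[OF p, of x] by (simp add: power2_norm_eq_inner inner_diff_left)
      also have "\<dots> \<le> norm x * norm (?p x)" by (rule norm_cauchy_schwarz)
      finally show ?thesis by (cases "?p x = 0") (simp_all add: power2_eq_square)
    qed
    then show "\<exists>K. \<forall>x. norm (?p x) \<le> norm x * K" by blast
  qed
qed

text \<open>The range need not be closed: by continuity, orthogonality to it extends to its closure,
  so \<open>x0\<close> is a minimizer exactly when \<open>f x0\<close> attains the
  projection.\<close>

lemma is_arg_min_norm_iff_range_proj:
  fixes f :: "'a::complex_inner \<Rightarrow> 'b::chilbert_space"
  assumes f: "bounded_clinear f"
  shows "is_arg_min (\<lambda>x. norm (f x - c)) (\<lambda>_. True) x0 \<longleftrightarrow> f x0 = range_proj f c"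
proof -
  interpret bounded_clinear f by fact
  have R: "subspace (range f)" by (intro linear_subspace_image linear_axioms subspace_UNIV)
  let ?K = "{z. inner (c - f x0) z = 0}"
  have "closed ?K" by (intro closed_Collect_eq continuous_intros)
  then have "closure (range f) \<subseteq> ?K \<longleftrightarrow> range f \<subseteq> ?K"
    using closure_minimal closure_subset by (metis subset_trans)
  then have "(\<forall>z\<in>closure (range f). inner (c - f x0) z = 0) \<longleftrightarrow> (\<forall>z\<in>range f. inner (c - f x0) z = 0)"
    by (simp add: subset_eq)
  moreover have "f x0 \<in> closure (range f)" by (rule subsetD[OF closure_subset]) simp
  ultimately have "range_proj f c = f x0 \<longleftrightarrow> (\<forall>z\<in>range f. inner (c - f x0) z = 0)"
    unfolding range_proj_eq_iff[OF f] by blast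
  also have "\<dots> \<longleftrightarrow> (\<forall>z\<in>range f. norm (c - f x0) \<le> norm (c - z))"
    by (rule closest_point_subspace_iff[OF R, symmetric]) simp
  finally show ?thesis by (auto simp: is_arg_min_linorder norm_minus_commute)
qed

section \<open>The weighted problems\<close>

lemma bounded_clinear_add:
  assumes "bounded_clinear f" "bounded_clinear g"
  shows "bounded_clinear (\<lambda>x. f x + g x)"
proof -
  interpret f: bounded_clinear f by fact
  interpret g: bounded_clinear g by fact
  show ?thesis
    by (intro bounded_clinear.intro bounded_linear_add f.bounded_linear_axioms
        g.bounded_linear_axioms bounded_clinear_axioms.intro)
      (simp add: f.scaleC g.scaleC scaleC_add_right)
qed

lemma bounded_clinear_diff:
  assumes "bounded_clinear f" "bounded_clinear g"
  shows "bounded_clinear (\<lambda>x. f x - g x)"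
proof -
  interpret f: bounded_clinear f by fact
  interpret g: bounded_clinear g by fact
  show ?thesis
    by (intro bounded_clinear.intro bounded_linear_sub f.bounded_linear_axioms
        g.bounded_linear_axioms bounded_clinear_axioms.intro)
      (simp add: f.scaleC g.scaleC linear_diff[OF bounded_linear.linear[OF bounded_linear_scaleC]])
qed

lemma bounded_clinear_compose:
  assumes "bounded_clinear f" "bounded_clinear g"
  shows "bounded_clinear (\<lambda>x. f (g x))"
proof -
  interpret f: bounded_clinear f by fact
  interpret g: bounded_clinear g by fact
  show ?thesis
    by (intro bounded_clinear.intro bounded_linear_compose[of f g] f.bounded_linear_axioms
        g.bounded_linear_axioms bounded_clinear_axioms.intro)
      (simp add: f.scaleC g.scaleC)
qed

lemma bounded_clinear_ident: "bounded_clinear (\<lambda>x. x)"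
  by (intro bounded_clinear.intro bounded_linear_ident bounded_clinear_axioms.intro) simp

text \<open>Moving \<open>cadjoint P\<close> across the inner product splits the weighted norm into
  the two components of \<open>y\<close> under \<open>P\<close>, so that each weighted problem
  becomes an ordinary one.\<close>

lemma wnorm_weight:
  fixes P :: "'a::chilbert_space \<Rightarrow> 'a"
  assumes "bounded_clinear P"
  shows "wnorm (weight P) y = sqrt ((norm (P y))\<^sup>2 + (norm (y - P y))\<^sup>2)"
proof -
  have adj: "inner (cadjoint P u) y = inner u (P y)" for u
    by (metis inner_cadjoint[OF assms] inner_commute)
  show ?thesis
    unfolding wnorm_def weight_def Re_cinner
    by (simp add: inner_add_left inner_diff_left inner_diff_right adj power2_norm_eq_inner)
qed

theorem proposition4p12:
  fixes A B P :: "'a::chilbert_space \<Rightarrow> 'a" and c x0 :: 'a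
  assumes "bounded_clinear A" and "bounded_clinear B"
    and "closed (range (\<lambda>x. A x + B x))"
    and "is_direct_sum (range (\<lambda>x. A x + B x)) (range A) (range B)"
    and "optimal_idempotent A B P"
  shows "is_arg_min (\<lambda>x. norm (A x + B x - c)) (\<lambda>_. True) x0 \<longleftrightarrow>
    is_arg_min (\<lambda>x. wnorm (weight P) (A x - c)) (\<lambda>_. True) x0 \<and>
    is_arg_min (\<lambda>x. wnorm (weight P) (B x - c)) (\<lambda>_. True) x0"
proof -
  define S where "S x = A x + B x" for x
  define T where "T x = range_proj A (P x) + range_proj B (x - P x)" for x
  have P: "bounded_clinear P" and idem: "\<And>x. P (P x) = P x" and PS: "\<And>x. P (S x) = A x"
    and sa: "selfadjoint T"
    using assms(5) by (auto simp: optimal_idempotent_def S_def T_def[abs_def])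
  interpret A: bounded_clinear A by fact
  interpret B: bounded_clinear B by fact
  interpret P: bounded_clinear P by fact
  have S: "bounded_clinear S"
    unfolding S_def[abs_def] by (intro bounded_clinear_add assms)
  have T: "bounded_clinear T"
    unfolding T_def[abs_def]
    by (rule bounded_clinear_add; rule bounded_clinear_compose)
      (intro bounded_clinear_range_proj bounded_clinear_diff bounded_clinear_ident P assms(1,2))+
  have PA: "P (A x) = A x" for x by (metis PS idem)
  \<comment> \<open>Subtract \<open>P (A x) = A x\<close> from \<open>P (S x) = A x\<close>.\<close>
  have PB: "P (B x) = 0" for x
    using PS[of x] PA[of x] by (simp add: S_def P.add)
  \<comment> \<open>The projections land only in the closures of the ranges, so the action of
    \<open>P\<close> is extended there by continuity.\<close>
  have PA': "P y = y" if "y \<in> closure (range A)" for y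
  proof -
    have "closed {y. P y = y}" by (intro closed_Collect_eq continuous_intros P.continuous_on)
    then have "closure (range A) \<subseteq> {y. P y = y}" by (intro closure_minimal) (auto simp: PA)
    then show ?thesis using that by blast
  qed
  have PB': "P y = 0" if "y \<in> closure (range B)" for y
  proof -
    have "closed {y. P y = 0}" by (intro closed_Collect_eq continuous_intros P.continuous_on)
    then have "closure (range B) \<subseteq> {y. P y = 0}" by (intro closure_minimal) (auto simp: PB)
    then show ?thesis using that by blast
  qed
  \<comment> \<open>These are the two summands of \<open>T c\<close>.\<close>
  define u v where "u = range_proj A (P c)" and "v = range_proj B (c - P c)"
  have u: "u \<in> closure (range A)" and v: "v \<in> closure (range B)"
    using range_proj_eq_iff[OF assms(1), of "P c" u] range_proj_eq_iff[OF assms(2), of "c - P c" v]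
    by (simp_all add: u_def v_def)

  have clS: "closure (range S) = range S" using assms(3) by (simp add: S_def[abs_def])
  have direct: "range S = {x + y | x y. x \<in> range A \<and> y \<in> range B}"
    using assms(4) by (simp add: is_direct_sum_def S_def[abs_def])
  have "range A \<subseteq> range S"
  proof clarify
    show "A x \<in> range S" for x
      unfolding direct
      by (rule CollectI, rule exI[of _ "A x"], rule exI[of _ "B 0"], intro conjI rangeI)
        (simp add: B.zero)
  qed
  moreover have "range B \<subseteq> range S"
  proof clarify
    show "B x \<in> range S" for x
      unfolding direct
      by (rule CollectI, rule exI[of _ "A 0"], rule exI[of _ "B x"], intro conjI rangeI)
        (simp add: A.zero)
  qed
  \<comment> \<open>Closedness of the range of \<open>S\<close> absorbs the closures of both smaller
    ranges.\<close>
  ultimately have "u \<in> range S" "v \<in> range S" using u v closure_mono clS by blast+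
  then have Tc: "T c \<in> closure (range S)"
    using bounded_clinear.closure_range_subspace[OF S] clS
    by (simp add: T_def subspace_add flip: u_def v_def)
  have TS: "T (S x) = S x" for x
  proof -
    have "range_proj A (A x) = A x" "range_proj B (B x) = B x"
      by (auto simp: range_proj_eq_iff assms(1,2) intro: subsetD[OF closure_subset])
    \<comment> \<open>\<open>PS\<close> must fire before \<open>S\<close> is unfolded; afterwards
      \<open>S x - A x\<close> becomes \<open>B x\<close>.\<close>
    then show ?thesis by (simp add: T_def PS) (simp add: S_def)
  qed
  \<comment> \<open>Selfadjointness moves \<open>T\<close> onto \<open>S x\<close>, which it
    fixes.\<close>
  have "inner (c - T c) (S x) = 0" for x
    using inner_cadjoint[OF T, of c "S x"] sa TS by (simp add: selfadjoint_def inner_diff_left)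
  then have "range_proj S c = T c"
    using Tc by (auto simp: range_proj_eq_iff[OF S] clS)
  then have 1: "is_arg_min (\<lambda>x. norm (S x - c)) (\<lambda>_. True) x0 \<longleftrightarrow> S x0 = u + v"
    by (simp add: is_arg_min_norm_iff_range_proj[OF S] T_def u_def v_def)

  \<comment> \<open>Since \<open>P\<close> fixes \<open>A x\<close>, the component of
    \<open>A x - c\<close> under \<open>I - P\<close> is independent of \<open>x\<close>; only the
    first square is minimized.\<close>
  have "wnorm (weight P) (A x - c) = sqrt ((norm (A x - P c))\<^sup>2 + (norm (c - P c))\<^sup>2)" for x
    by (simp add: wnorm_weight[OF P] P.diff PA norm_minus_commute)
  then have 2: "is_arg_min (\<lambda>x. wnorm (weight P) (A x - c)) (\<lambda>_. True) x0 \<longleftrightarrow> A x0 = u"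
    unfolding u_def is_arg_min_norm_iff_range_proj[OF assms(1), symmetric]
    by (simp add: is_arg_min_linorder)

  \<comment> \<open>Here the roles swap: \<open>P\<close> kills \<open>B x\<close>, so the first
    square is constant.\<close>
  have "wnorm (weight P) (B x - c) = sqrt ((norm (P c))\<^sup>2 + (norm (B x - (c - P c)))\<^sup>2)" for x
    by (simp add: wnorm_weight[OF P] P.diff PB) (simp add: algebra_simps)
  then have 3: "is_arg_min (\<lambda>x. wnorm (weight P) (B x - c)) (\<lambda>_. True) x0 \<longleftrightarrow> B x0 = v"
    unfolding v_def is_arg_min_norm_iff_range_proj[OF assms(2), symmetric]
    by (simp add: is_arg_min_linorder)

  have "S x0 = u + v \<longleftrightarrow> A x0 = u \<and> B x0 = v"
  proof
    assume *: "S x0 = u + v"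
    \<comment> \<open>Apply \<open>P\<close>, which fixes \<open>u\<close> and kills
      \<open>v\<close>; cancelling \<open>u\<close> then leaves the equation for
      \<open>B\<close>.\<close>
    then have "A x0 = u" using PS[of x0] PA'[OF u] PB'[OF v] by (simp add: P.add)
    with * show "A x0 = u \<and> B x0 = v" by (simp add: S_def)
  qed (simp add: S_def)
  then show ?thesis using 1 2 3 by (simp add: S_def)
qed

end
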